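(* Let $X$ be a Hausdorff topological space and let $p\in X$. Then $p$ is a weak P-point of $X$ if and only if $p$ avoids purely atomic measures, i.e. for every purely atomic measure $\mu$ on $X$ with $\mu(\{p\})=0$ we have $p\notin \mathrm{supp}(\mu)$.
   Context: A measure on a topological space $X$ is a $\sigma$-additive Radon probability measure on the Borel sets of $X$ (inner regular with respect to compact sets, outer regular with respect to open sets). The support of $\mu$ is $\mathrm{supp}(\mu)=\bigcap\{C\subseteq X: C \text{ closed},\ \mu(C)=1\}$. A measure on $X$ is purely atomic if it is a countable weighted sum of $0$-$1$ measures (where a $0$-$1$ measure is a $\sigma$-additive Radon probability measure on the Borel sets of $X$, inner regular with respect to compact sets and outer regular with respect to open sets, taking only the values $0$ and $1$). A point $p\in X$ is a weak P-point if $p$ is not a limit point of any countable subset of $X\setminus\{p\}$, i.e. $p\notin\overline{C}$ for every countable $C\subseteq X\setminus\{p\}$. *)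

theory Defs
  imports "HOL-Probability.Probability"
begin

text \<open>
  In a Hausdorff space compact sets are closed, hence Borel, so every \<open>emeasure M K\<close> below is the
  measure of a measurable set.
\<close>

definition radon_prob_measure :: "'a::t2_space measure \<Rightarrow> bool" where
  "radon_prob_measure M \<longleftrightarrow>
     prob_space M \<and> sets M = sets borel \<and>
     (\<forall>B\<in>sets borel. emeasure M B = (SUP K\<in>{K. compact K \<and> K \<subseteq> B}. emeasure M K)) \<and>
     (\<forall>B\<in>sets borel. emeasure M B = (INF U\<in>{U. open U \<and> B \<subseteq> U}. emeasure M U))"

definition measure_support :: "'a::t2_space measure \<Rightarrow> 'a set" where
  "measure_support M = \<Inter> {C. closed C \<and> emeasure M C = 1}"

definition zero_one_measure :: "'a::t2_space measure \<Rightarrow> bool" where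
  "zero_one_measure M \<longleftrightarrow>
     radon_prob_measure M \<and> (\<forall>B\<in>sets borel. emeasure M B = 0 \<or> emeasure M B = 1)"

text \<open>
  The index set \<open>I\<close> may be finite or infinite. That the weights sum to 1 follows by taking
  \<open>B = UNIV\<close>.
\<close>

definition purely_atomic_measure :: "'a::t2_space measure \<Rightarrow> bool" where
  "purely_atomic_measure M \<longleftrightarrow>
     radon_prob_measure M \<and>
     (\<exists>(I :: nat set) (w :: nat \<Rightarrow> real) (N :: nat \<Rightarrow> 'a measure).
        (\<forall>i\<in>I. 0 \<le> w i \<and> zero_one_measure (N i)) \<and>
        (\<forall>B\<in>sets borel. ((\<lambda>i. w i * measure (N i) B) has_sum measure M B) I))"

definition weak_P_point :: "'a::t2_space \<Rightarrow> bool" where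
  "weak_P_point p \<longleftrightarrow> (\<forall>C. countable C \<and> C \<subseteq> - {p} \<longrightarrow> p \<notin> closure C)"

definition avoids_purely_atomic_measures :: "'a::t2_space \<Rightarrow> bool" where
  "avoids_purely_atomic_measures p \<longleftrightarrow>
     (\<forall>M. purely_atomic_measure M \<and> emeasure M {p} = 0 \<longrightarrow> p \<notin> measure_support M)"

end

theory Submission
  imports Defs
begin

text \<open>
  A zero-one Radon measure on a Hausdorff space is a point mass: a compact set of measure one cannot
  be covered by open null sets. Hence a purely atomic measure without mass at \<open>p\<close> is concentrated on
  a countable set that misses \<open>p\<close>, and the closure of that set contains the support. Conversely, a
  countable set that accumulates at \<open>p\<close> carries a measure with positive weight at each of its
  points, and the support of this measure contains \<open>p\<close>.
\<close>

text \<open>Passes from the integral-based \<open>infsetsum\<close> to \<open>has_sum\<close>, the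
  notion of summation in which \<open>purely_atomic_measure\<close> is stated.\<close>

lemma has_sum_pmf: "(pmf q has_sum measure q A) A"
proof -
  have summable: "pmf q summable_on A"
    using pmf_abs_summable[of q A] abs_summable_equivalent abs_summable_summable by blast
  have "measure q A = infsetsum (pmf q) A"
    by (rule measure_pmf_conv_infsetsum)
  also have "\<dots> = infsum (pmf q) A"
    by (rule infsetsum_infsum) (rule pmf_abs_summable)
  finally show ?thesis
    using summable by (simp add: has_sum_infsum)
qed

text \<open>The source of both regularity properties of a discrete measure: finite sets are compact,
  and in a Hausdorff space their complements are open.\<close>

lemma pmf_finite_approx:
  fixes e :: real
  assumes "e > 0"
  obtains F where "finite F" "F \<subseteq> A" "measure (measure_pmf q) A \<le> measure (measure_pmf q) F + e"
proof -
  have "\<forall>\<^sub>F F in finite_subsets_at_top A. dist (sum (pmf q) F) (measure q A) < e"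
    using has_sum_pmf[of q A] assms unfolding has_sum_def tendsto_iff by blast
  then obtain F where F: "finite F" "F \<subseteq> A" "dist (sum (pmf q) F) (measure q A) < e"
    unfolding eventually_finite_subsets_at_top by blast
  moreover have "measure q F = sum (pmf q) F"
    using F(1) by (rule measure_measure_pmf_finite)
  ultimately show thesis
    by (intro that[of F]) (auto simp: dist_real_def)
qed

text \<open>In \<open>measure_pmf q\<close> every set is measurable, while a Radon measure must have
  exactly the Borel sets. The image under the identity restricts the sigma-algebra and keeps the
  values.\<close>

definition borel_of_pmf :: "'a::t2_space pmf \<Rightarrow> 'a measure" where
  "borel_of_pmf q = distr (measure_pmf q) borel (\<lambda>x. x)"

lemma sets_borel_of_pmf [simp]: "sets (borel_of_pmf q) = sets borel"
  by (simp add: borel_of_pmf_def)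

lemma emeasure_borel_of_pmf:
  "B \<in> sets borel \<Longrightarrow> emeasure (borel_of_pmf q) B = emeasure (measure_pmf q) B"
  by (simp add: borel_of_pmf_def emeasure_distr)

lemma measure_borel_of_pmf:
  "B \<in> sets borel \<Longrightarrow> measure (borel_of_pmf q) B = measure (measure_pmf q) B"
  by (simp add: measure_def emeasure_borel_of_pmf)

lemma radon_prob_measure_borel_of_pmf: "radon_prob_measure (borel_of_pmf q)"
  unfolding radon_prob_measure_def
proof (intro conjI ballI)
  let ?M = "borel_of_pmf q"
  show "prob_space ?M"
    unfolding borel_of_pmf_def by (rule measure_pmf.prob_space_distr) simp
  show "sets ?M = sets borel"
    by simp
  fix B :: "'a set"
  assume B: "B \<in> sets borel"
  show "emeasure ?M B = (SUP K\<in>{K. compact K \<and> K \<subseteq> B}. emeasure ?M K)" (is "_ = ?S")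
  proof (rule antisym)
    show "?S \<le> emeasure ?M B"
      using B by (intro SUP_least emeasure_mono) auto
    show "emeasure ?M B \<le> ?S"
    proof (rule ennreal_le_epsilon)
      fix e :: real assume "0 < e"
      then obtain F where F: "finite F" "F \<subseteq> B" "measure q B \<le> measure q F + e"
        by (rule pmf_finite_approx)
      have "emeasure ?M B \<le> emeasure ?M F + ennreal e"
        using F B \<open>0 < e\<close>
        by (simp add: emeasure_borel_of_pmf finite_imp_closed measure_pmf.emeasure_eq_measure
            flip: ennreal_plus)
      also have "emeasure ?M F \<le> ?S"
        using F by (intro SUP_upper) (auto simp: finite_imp_compact)
      finally show "emeasure ?M B \<le> ?S + ennreal e"
        by (simp add: add_right_mono)
    qed
  qed
  show "emeasure ?M B = (INF U\<in>{U. open U \<and> B \<subseteq> U}. emeasure ?M U)" (is "_ = ?I")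
  proof (rule antisym)
    show "emeasure ?M B \<le> ?I"
      by (intro INF_greatest emeasure_mono) auto
    show "?I \<le> emeasure ?M B"
    proof (rule ennreal_le_epsilon)
      fix e :: real assume "0 < e"
      \<comment> \<open>Outer regularity at \<open>B\<close> is finite approximation of the
        complement: \<open>- F\<close> is an open superset of \<open>B\<close> whose measure exceeds
        that of \<open>B\<close> by at most \<open>e\<close>.\<close>
      then obtain F where F: "finite F" "F \<subseteq> - B" "measure q (- B) \<le> measure q F + e"
        by (rule pmf_finite_approx)
      have compl: "measure q (- A) = 1 - measure q A" for A
        using measure_pmf.prob_compl[of A q] by (simp add: Compl_eq_Diff_UNIV)
      have "?I \<le> emeasure ?M (- F)"
        using F by (intro INF_lower) (auto simp: finite_imp_closed open_Compl)
      also have "\<dots> \<le> emeasure ?M B + ennreal e"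
        using F B \<open>0 < e\<close>
        by (simp add: emeasure_borel_of_pmf finite_imp_closed measure_pmf.emeasure_eq_measure
            compl flip: ennreal_plus)
      finally show "?I \<le> emeasure ?M B + ennreal e" .
    qed
  qed
qed

lemma zero_one_measure_borel_of_return_pmf: "zero_one_measure (borel_of_pmf (return_pmf x))"
  unfolding zero_one_measure_def
  by (auto simp: radon_prob_measure_borel_of_pmf emeasure_borel_of_pmf indicator_def)

text \<open>The weights are \<open>pmf q i\<close> and the components are point masses at
  \<open>c i\<close>. Since the sum runs over indices, \<open>c\<close> may repeat points; their
  weights simply add up.\<close>

lemma purely_atomic_borel_of_map_pmf:
  fixes q :: "nat pmf"
  shows "purely_atomic_measure (borel_of_pmf (map_pmf c q))"
proof -
  let ?N = "\<lambda>i. borel_of_pmf (return_pmf (c i))"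
  have "((\<lambda>i. pmf q i * measure (?N i) B) has_sum measure (borel_of_pmf (map_pmf c q)) B) UNIV"
    if B: "B \<in> sets borel" for B
  proof -
    \<comment> \<open>The factor \<open>measure (?N i) B\<close> is 1 or 0 according to whether
      \<open>c i\<close> lies in \<open>B\<close>, so only the indices in the preimage of
      \<open>B\<close> contribute.\<close>
    have "((\<lambda>i. pmf q i * measure (?N i) B) has_sum measure q (c -` B)) UNIV \<longleftrightarrow>
          (pmf q has_sum measure q (c -` B)) (c -` B)"
      using B by (intro has_sum_cong_neutral) (auto simp: measure_borel_of_pmf measure_return)
    thus ?thesis
      using B has_sum_pmf[of q "c -` B"] by (simp add: measure_borel_of_pmf)
  qed
  thus ?thesis
    unfolding purely_atomic_measure_def
    by (intro conjI radon_prob_measure_borel_of_pmf exI[of _ UNIV] exI[of _ "pmf q"] exI[of _ ?N])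
       (auto simp: zero_one_measure_borel_of_return_pmf)
qed

lemma zero_one_measure_point:
  fixes N :: "'a::t2_space measure"
  assumes "zero_one_measure N"
  obtains x where "emeasure N {x} = 1"
proof -
  from assms have N: "prob_space N" and sets: "sets N = sets borel"
    and inner: "\<And>B. B \<in> sets borel \<Longrightarrow>
      emeasure N B = (SUP K\<in>{K. compact K \<and> K \<subseteq> B}. emeasure N K)"
    and outer: "\<And>B. B \<in> sets borel \<Longrightarrow>
      emeasure N B = (INF U\<in>{U. open U \<and> B \<subseteq> U}. emeasure N U)"
    and zero_one: "\<And>B. B \<in> sets borel \<Longrightarrow> emeasure N B = 0 \<or> emeasure N B = 1"
    unfolding zero_one_measure_def radon_prob_measure_def by blast+
  interpret prob_space N by fact
  \<comment> \<open>Inner regularity of the whole space yields a compact set of positive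
    measure.\<close>
  have "0 < (SUP K\<in>{K. compact K \<and> K \<subseteq> (UNIV :: 'a set)}. emeasure N K)"
    using inner[of UNIV] emeasure_space_1 sets_eq_imp_space_eq[OF sets] by simp
  then obtain K where K: "compact K" "emeasure N K > 0"
    by (auto simp: less_SUP_iff)
  have "\<exists>x\<in>K. \<forall>U. open U \<and> x \<in> U \<longrightarrow> emeasure N U \<noteq> 0"
  proof (rule ccontr)
    assume "\<not> ?thesis"
    hence cover: "K \<subseteq> \<Union> {U. open U \<and> emeasure N U = 0}"
      by blast
    obtain \<C> where \<C>: "\<C> \<subseteq> {U. open U \<and> emeasure N U = 0}" "finite \<C>" "K \<subseteq> \<Union> \<C>"
      by (rule compactE[OF K(1) cover]) auto
    have "(\<Union>U\<in>\<C>. U) \<in> null_sets N"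
      using \<C> by (intro null_sets_UN') (auto simp: null_sets_def sets intro: countable_finite)
    hence "emeasure N K = 0"
      using \<C>(3) by (auto intro: emeasure_eq_0)
    with K show False by simp
  qed
  then obtain x where "\<And>U. open U \<Longrightarrow> x \<in> U \<Longrightarrow> emeasure N U \<noteq> 0"
    by blast
  hence nhds: "emeasure N U = 1" if "open U" "x \<in> U" for U
    using zero_one[of U] that by auto
  \<comment> \<open>Every open neighbourhood of \<open>x\<close> has measure one, and outer
    regularity transfers this to the point.\<close>
  have "1 \<le> emeasure N {x}"
    by (subst outer) (auto intro!: INF_greatest simp: nhds)
  thus thesis
    using zero_one[of "{x}"] by (intro that[of x]) auto
qed

lemma weak_P_point_imp_avoids:
  fixes p :: "'a::t2_space"
  assumes "weak_P_point p"
  shows "avoids_purely_atomic_measures p"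
  unfolding avoids_purely_atomic_measures_def
proof (intro allI impI, elim conjE)
  fix M :: "'a measure"
  assume "purely_atomic_measure M" and p: "emeasure M {p} = 0"
  then obtain I :: "nat set" and w :: "nat \<Rightarrow> real" and N :: "nat \<Rightarrow> 'a measure" where
    M: "prob_space M" "sets M = sets borel"
    and w: "\<And>i. i \<in> I \<Longrightarrow> 0 \<le> w i" and N: "\<And>i. i \<in> I \<Longrightarrow> zero_one_measure (N i)"
    and sum: "\<And>B. B \<in> sets borel \<Longrightarrow> ((\<lambda>i. w i * measure (N i) B) has_sum measure M B) I"
    unfolding purely_atomic_measure_def radon_prob_measure_def by blast
  interpret M: prob_space M by fact
  have "\<forall>i\<in>I. \<exists>x. emeasure (N i) {x} = 1"
    using zero_one_measure_point[OF N] by metis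
  then obtain x where x: "\<And>i. i \<in> I \<Longrightarrow> emeasure (N i) {x i} = 1"
    unfolding bchoice_iff by blast
  have N1: "measure (N i) B = 1" if "i \<in> I" "B \<in> sets borel" "x i \<in> B" for i B
  proof -
    interpret prob_space "N i"
      using N[OF that(1)] by (simp add: zero_one_measure_def radon_prob_measure_def)
    have "sets (N i) = sets borel"
      using N[OF that(1)] by (simp add: zero_one_measure_def radon_prob_measure_def)
    hence "emeasure (N i) {x i} \<le> emeasure (N i) B"
      using that by (intro emeasure_mono) auto
    thus ?thesis
      using x[OF that(1)] prob_le_1[of B] by (simp add: emeasure_eq_measure antisym)
  qed
  \<comment> \<open>Zero weights are allowed, and the point of such a component may be
    \<open>p\<close> itself, so these indices are left out.\<close>
  define C where "C = x ` {i \<in> I. w i \<noteq> 0}"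
  have "x i \<noteq> p" if i: "i \<in> I" "w i \<noteq> 0" for i
  proof
    assume "x i = p"
    \<comment> \<open>A series of nonnegative terms with sum 0 has only zero terms, but an atom at
      \<open>p\<close> would contribute its nonzero weight.\<close>
    have "((\<lambda>i. w i * measure (N i) {p}) has_sum 0) I"
      using sum[of "{p}"] p by (simp add: measure_def)
    hence "w i * measure (N i) {p} = 0"
      by (rule nonneg_has_sum_le_0D) (use i w in auto)
    with N1[of i "{p}"] i \<open>x i = p\<close> show False
      by simp
  qed
  hence "countable C" "C \<subseteq> - {p}"
    by (auto simp: C_def)
  hence "p \<notin> closure C"
    using assms by (simp add: weak_P_point_def)
  moreover have "emeasure M (closure C) = 1"
  proof -
    \<comment> \<open>The series for \<open>closure C\<close> and for the whole space agree term by
      term, so both sets have the same measure.\<close>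
    have "w i * measure (N i) (closure C) = w i * measure (N i) UNIV" if "i \<in> I" for i
    proof (cases "w i = 0")
      case False
      with that have "x i \<in> closure C"
        using closure_subset by (fastforce simp: C_def)
      thus ?thesis
        using N1 that by simp
    qed simp
    hence "((\<lambda>i. w i * measure (N i) UNIV) has_sum measure M (closure C)) I"
      using sum[of "closure C"] has_sum_cong[of I "\<lambda>i. w i * measure (N i) (closure C)"
        "\<lambda>i. w i * measure (N i) UNIV"] by auto
    hence "measure M (closure C) = measure M UNIV"
      by (rule has_sum_unique) (simp add: sum)
    thus ?thesis
      using M.prob_space sets_eq_imp_space_eq[OF M(2)] by (simp add: M.emeasure_eq_measure)
  qed
  ultimately show "p \<notin> measure_support M"
    unfolding measure_support_def using closed_closure by blast
qed

lemma avoids_imp_weak_P_point: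
  fixes p :: "'a::t2_space"
  assumes "avoids_purely_atomic_measures p"
  shows "weak_P_point p"
  unfolding weak_P_point_def
proof (intro allI impI notI, elim conjE)
  fix C :: "'a set"
  assume C: "countable C" "C \<subseteq> - {p}" and p: "p \<in> closure C"
  hence "C \<noteq> {}"
    by auto
  \<comment> \<open>The geometric distribution charges every natural number; any parameter strictly
    between 0 and 1 would do. The enumeration has range \<open>C\<close> because \<open>C\<close> is
    nonempty, and it repeats points if \<open>C\<close> is finite.\<close>
  define q where "q = map_pmf (from_nat_into C) (geometric_pmf (1/2))"
  have set_q: "set_pmf q = C"
    using C \<open>C \<noteq> {}\<close> by (simp add: q_def set_pmf_geometric range_from_nat_into)
  have "emeasure (borel_of_pmf q) {p} = 0"
    using C set_q by (auto simp: emeasure_borel_of_pmf emeasure_pmf_single pmf_eq_0_set_pmf)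
  moreover have "purely_atomic_measure (borel_of_pmf q)"
    unfolding q_def by (rule purely_atomic_borel_of_map_pmf)
  \<comment> \<open>A set of full measure contains every point of positive weight, hence all of
    \<open>C\<close>; being closed, it then contains \<open>closure C\<close>.\<close>
  moreover have "p \<in> D" if "closed D" "emeasure (borel_of_pmf q) D = 1" for D
  proof -
    have "measure q D = 1"
      using that by (simp add: emeasure_borel_of_pmf measure_def)
    hence "C \<subseteq> D"
      by (simp add: measure_pmf.prob_eq_1 AE_measure_pmf_iff set_q subset_eq)
    thus ?thesis
      using p closure_minimal \<open>closed D\<close> by blast
  qed
  ultimately show False
    using assms unfolding avoids_purely_atomic_measures_def measure_support_def by blast
qed

theorem proposition4p4:
  fixes p :: "'a::t2_space"
  shows "weak_P_point p \<longleftrightarrow> avoids_purely_atomic_measures p"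
  using weak_P_point_imp_avoids avoids_imp_weak_P_point by blast

end
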